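(* Let $\mathcal X,\mathcal Y$ be normed vector spaces, $T:\mathcal X\to\mathcal Y$ a bounded linear operator, $y\in\mathcal Y$, $\alpha>0$, $\mathcal D\subset\mathcal X$ a nonempty convex set and $W:\mathcal D\to\mathbb R$ a functional satisfying the following hypotheses: (1) there exists $\gamma\ge 0$ such that $W(x)\ge-\gamma$ for all $x\in\mathcal D$; (2) for every $W$-bounded sequence $\{x_n\}\subset\mathcal D$ such that $x_n$ converges weakly to some $x\in\mathcal D$, there exists a subsequence $\{x_{n_j}\}$ of $\{x_n\}$ such that $W(x)\le\liminf_{j\to\infty}W(x_{n_j})$; (3) for every $W$-bounded sequence $\{x_n\}\subset\mathcal D$ there exist a subsequence $\{x_{n_j}\}$ and $x\in\mathcal D$ such that $x_{n_j}$ converges weakly to $x$. Then the functional $J_{W,\alpha}(x)=\|Tx-y\|^2+\alpha W(x)$, $x\in\mathcal D$, has a global minimizer on $\mathcal D$. If moreover $W$ is convex and $T$ is injective, or $W$ is strictly convex, then such a minimizer is unique.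
   Context: A sequence $\{x_n\}\subset\mathcal D$ (or, more generally, a subset of $\mathcal D$) is called $W$-bounded if there exists a constant $k<\infty$ such that $|W(x)|\le k$ for every element $x$ of it. Weak convergence is weak convergence in the normed space $\mathcal X$.
   Formalization: Uniqueness for W convex and T injective is stated only when the norm of 𝒴 is strictly convex (unit sphere contains no segment); without this it fails, e.g. 𝒴=ℝ² with max norm, Tx=(x,0), y=(0,1), 𝒟=[-1,1], W=0. *)

theory Defs
  imports "HOL-Analysis.Analysis"
begin

text \<open>Weak convergence is tested on real functionals. For complex spaces this is the usual notion
  on the underlying real space, because a bounded complex functional is determined by its real
  part.\<close>

definition weakly_converges :: "(nat \<Rightarrow> 'a::real_normed_vector) \<Rightarrow> 'a \<Rightarrow> bool"
  where "weakly_converges x l \<longleftrightarrow>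
    (\<forall>f :: 'a \<Rightarrow> real. bounded_linear f \<longrightarrow> (\<lambda>n. f (x n)) \<longlonglongrightarrow> f l)"

definition W_bounded :: "('a \<Rightarrow> real) \<Rightarrow> 'a set \<Rightarrow> bool"
  where "W_bounded W S \<longleftrightarrow> (\<exists>k. \<forall>x\<in>S. \<bar>W x\<bar> \<le> k)"

definition strictly_convex_on :: "'a::real_vector set \<Rightarrow> ('a \<Rightarrow> real) \<Rightarrow> bool"
  where "strictly_convex_on S f \<longleftrightarrow> convex S \<and>
    (\<forall>x\<in>S. \<forall>y\<in>S. \<forall>u>0. \<forall>v>0. x \<noteq> y \<longrightarrow> u + v = 1 \<longrightarrow>
      f (u *\<^sub>R x + v *\<^sub>R y) < u * f x + v * f y)"

definition J_functional ::
    "('a \<Rightarrow> 'b::real_normed_vector) \<Rightarrow> 'b \<Rightarrow> ('a \<Rightarrow> real) \<Rightarrow> real \<Rightarrow> 'a \<Rightarrow> real"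
  where "J_functional T y W \<alpha> x = (norm (T x - y))\<^sup>2 + \<alpha> * W x"

text \<open>Strict convexity (rotundity) of a normed space: the unit sphere contains no segment.
  It is needed for uniqueness when \<open>W\<close> is only convex: if the norm of the codomain is not rotund,
  then \<open>x \<mapsto> \<parallel>T x - y\<parallel>\<^sup>2\<close> need not be strictly convex for injective \<open>T\<close>, and uniqueness can fail.
  For example, take \<open>W = 0\<close>, the domain \<open>[-1, 1]\<close> and \<open>T x = (x, 0)\<close>, \<open>y = (0, 1)\<close> in the plane with
  the maximum norm; then every \<open>x\<close> in \<open>[-1, 1]\<close> is a minimizer. Inner product spaces are rotund.\<close>

definition rotund :: "'b::real_normed_vector itself \<Rightarrow> bool"
  where "rotund _ \<longleftrightarrow>
    (\<forall>u v :: 'b. norm u = 1 \<longrightarrow> norm v = 1 \<longrightarrow> u \<noteq> v \<longrightarrow> norm (u + v) < 2)"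

lemma rotund_inner: "rotund TYPE('b::real_inner)"
  unfolding rotund_def
proof (intro allI impI)
  fix u v :: 'b
  assume uv: "norm u = 1" "norm v = 1" "u \<noteq> v"
  have "norm (u + v) \<noteq> norm u + norm v"
    using uv norm_triangle_eq[of u v] by auto
  with norm_triangle_ineq[of u v] uv show "norm (u + v) < 2"
    by simp
qed

end

theory Submission
  imports Defs
begin

text \<open>Existence is the direct method. A minimizing sequence in \<open>D\<close> has \<open>W\<close> bounded above because
  the discrepancy term is nonnegative and \<open>\<alpha> > 0\<close>, and bounded below by assumption. It therefore
  has a subsequence with a weak limit \<open>l \<in> D\<close> along which \<open>W l\<close> is at most the lower limit of \<open>W\<close>.
  What remains is that the discrepancy \<open>\<parallel>T x - y\<parallel>\<^sup>2\<close> does not jump up in the limit. This is seen by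
  testing with one functional: the Hahn-Banach theorem provides a linear \<open>f\<close> on the codomain with
  \<open>\<bar>f v\<bar> \<le> \<parallel>v\<parallel>\<close> everywhere and equality at \<open>T l - y\<close> (\<open>norming_functional\<close>). Since \<open>f \<circ> T\<close> is
  bounded and linear, \<open>f (T x - y)\<close> converges along the subsequence to \<open>\<parallel>T l - y\<parallel>\<close>, while its square
  stays below the discrepancy (\<open>tikhonov_minimizer_of_weak_limit\<close>).

  The Hahn-Banach theorem is obtained from Zorn's lemma on sublinear functionals ordered pointwise,
  rather than on partially defined linear ones: a minimal sublinear functional is linear
  (\<open>minimal_sublinear_imp_linear\<close>). The operation \<open>directional_reduction\<close>, which lowers a sublinear
  functional by as much as is needed to make it odd along one direction, is used twice: to prove that
  minimality implies linearity, and, applied to the norm, to force the desired value at the given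
  vector.

  Uniqueness compares two distinct minimizers with their midpoint. Both the squared discrepancy and
  \<open>W\<close> are midpoint convex, and under either hypothesis one of them strictly so; for the squared
  discrepancy this is what rotundity of the codomain and injectivity of \<open>T\<close> give. The midpoint
  would then have a smaller value than the minimum.\<close>

section \<open>Norming functionals\<close>

definition sublinear :: "('a::real_vector \<Rightarrow> real) \<Rightarrow> bool"
  where "sublinear q \<longleftrightarrow>
    (\<forall>u v. q (u + v) \<le> q u + q v) \<and> (\<forall>t\<ge>0. \<forall>u. q (t *\<^sub>R u) = t * q u)"

lemma sublinear_add: "sublinear q \<Longrightarrow> q (u + v) \<le> q u + q v"
  by (simp add: sublinear_def)

lemma sublinear_scale: "sublinear q \<Longrightarrow> t \<ge> 0 \<Longrightarrow> q (t *\<^sub>R u) = t * q u"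
  by (simp add: sublinear_def)

lemma sublinear_zero: "sublinear q \<Longrightarrow> q 0 = 0"
  using sublinear_scale[of q 0 0] by simp

lemma sublinear_norm: "sublinear (norm :: 'a::real_normed_vector \<Rightarrow> real)"
  by (simp add: sublinear_def norm_triangle_ineq)

lemma sublinear_lower: "sublinear q \<Longrightarrow> - q (- u) \<le> q u"
  using sublinear_add[of q u "- u"] sublinear_zero[of q] by simp

text \<open>For an infimum to be sublinear, no single member has to be: it suffices that sums and positive
  multiples of values of members are bounded below by values of members. This covers both uses below.
  In a chain of sublinear functionals the smaller of two members serves for their sum; in the
  directional reduction the parameters add up and scale along.\<close>

lemma sublinear_INF:
  fixes h :: "'i \<Rightarrow> 'a::real_vector \<Rightarrow> real"
  assumes ne: "I \<noteq> {}"
    and bdd: "\<And>u. bdd_below ((\<lambda>i. h i u) ` I)"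
    and add: "\<And>i j u v. i \<in> I \<Longrightarrow> j \<in> I \<Longrightarrow> \<exists>k\<in>I. h k (u + v) \<le> h i u + h j v"
    and zero: "\<And>i. i \<in> I \<Longrightarrow> h i 0 = 0"
    and scale: "\<And>i t u. i \<in> I \<Longrightarrow> t > 0 \<Longrightarrow> \<exists>k\<in>I. h k (t *\<^sub>R u) \<le> t * h i u"
  shows "sublinear (\<lambda>u. INF i\<in>I. h i u)"
proof -
  define g where "g u = (INF i\<in>I. h i u)" for u
  have lower: "g u \<le> h i u" if "i \<in> I" for i u
    unfolding g_def using bdd that by (rule cINF_lower)
  have greatest: "c \<le> g u" if "\<And>i. i \<in> I \<Longrightarrow> c \<le> h i u" for c u
    unfolding g_def using ne that by (rule cINF_greatest)
  have g_add: "g (u + v) \<le> g u + g v" for u v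
  proof -
    have "g (u + v) - h i u \<le> h j v" if "i \<in> I" "j \<in> I" for i j
      using add[OF that, of u v] lower[of _ "u + v"] by fastforce
    then have "g (u + v) - h i u \<le> g v" if "i \<in> I" for i
      using that by (intro greatest)
    then have "g (u + v) - g v \<le> h i u" if "i \<in> I" for i
      using that by fastforce
    then have "g (u + v) - g v \<le> g u"
      by (intro greatest)
    then show ?thesis by simp
  qed
  have g_zero: "g 0 = 0"
    unfolding g_def using ne zero by simp
  have g_scale_le: "g (t *\<^sub>R u) \<le> t * g u" if "t > 0" for t u
  proof -
    have "g (t *\<^sub>R u) / t \<le> h i u" if "i \<in> I" for i
      using scale[OF that \<open>t > 0\<close>, of u] lower[of _ "t *\<^sub>R u"] \<open>t > 0\<close>
      by (fastforce simp: divide_le_eq mult.commute)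
    then have "g (t *\<^sub>R u) / t \<le> g u"
      by (intro greatest)
    with \<open>t > 0\<close> show ?thesis
      by (simp add: divide_le_eq mult.commute)
  qed
  have g_scale: "g (t *\<^sub>R u) = t * g u" if "t > 0" for t u
  proof (rule antisym[OF g_scale_le[OF that]])
    \<comment> \<open>The reverse inequality is the one just proved, for the factor \<open>1 / t\<close>.\<close>
    have "g u \<le> g (t *\<^sub>R u) / t"
      using g_scale_le[of "1 / t" "t *\<^sub>R u"] that by simp
    then show "t * g u \<le> g (t *\<^sub>R u)"
      using that by (simp add: le_divide_eq mult.commute)
  qed
  have "g (t *\<^sub>R u) = t * g u" if "t \<ge> 0" for t u
    using g_scale g_zero that by (cases "t = 0") auto
  with g_add show ?thesis
    unfolding sublinear_def g_def by blast
qed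

text \<open>For sublinear \<open>q\<close> this is the largest sublinear functional below \<open>q\<close> whose value at \<open>- z\<close> is at
  most \<open>- q z\<close>: any such \<open>r\<close> satisfies \<open>r u \<le> r (u + t z) + t r (- z) \<le> q (u + t z) - t q z\<close>.\<close>

definition directional_reduction :: "('a::real_vector \<Rightarrow> real) \<Rightarrow> 'a \<Rightarrow> 'a \<Rightarrow> real"
  where "directional_reduction q z u = (INF t\<in>{0..}. q (u + t *\<^sub>R z) - t * q z)"

lemma bdd_below_directional_reduction:
  assumes "sublinear q"
  shows "bdd_below ((\<lambda>t. q (u + t *\<^sub>R z) - t * q z) ` {0..})"
proof (rule bdd_belowI2[where m = "- q (- u)"])
  fix t :: real
  assume "t \<in> {0..}"
  then have "t * q z = q (t *\<^sub>R z)"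
    using assms by (simp add: sublinear_scale)
  then show "- q (- u) \<le> q (u + t *\<^sub>R z) - t * q z"
    using sublinear_add[OF assms, of "u + t *\<^sub>R z" "- u"] by simp
qed

lemma directional_reduction_le:
  assumes "sublinear q" "t \<ge> 0"
  shows "directional_reduction q z u \<le> q (u + t *\<^sub>R z) - t * q z"
  unfolding directional_reduction_def
  using assms by (intro cINF_lower bdd_below_directional_reduction) auto

lemma sublinear_directional_reduction:
  assumes q: "sublinear q"
  shows "sublinear (directional_reduction q z)"
  unfolding directional_reduction_def
proof (rule sublinear_INF)
  show "bdd_below ((\<lambda>t. q (u + t *\<^sub>R z) - t * q z) ` {0..})" for u
    using q by (rule bdd_below_directional_reduction)
next
  fix s t :: real and u v
  assume st: "s \<in> {0..}" "t \<in> {0..}"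
  have "q ((u + v) + (s + t) *\<^sub>R z) - (s + t) * q z
      \<le> (q (u + s *\<^sub>R z) - s * q z) + (q (v + t *\<^sub>R z) - t * q z)"
    using sublinear_add[OF q, of "u + s *\<^sub>R z" "v + t *\<^sub>R z"]
    by (simp add: algebra_simps)
  with st show "\<exists>k\<in>{0..}. q ((u + v) + k *\<^sub>R z) - k * q z
      \<le> (q (u + s *\<^sub>R z) - s * q z) + (q (v + t *\<^sub>R z) - t * q z)"
    by (intro bexI[where x = "s + t"]) auto
next
  fix t :: real
  assume "t \<in> {0..}"
  then show "q (0 + t *\<^sub>R z) - t * q z = 0"
    using q by (simp add: sublinear_scale)
next
  fix s t :: real and u
  assume st: "s \<in> {0..}" "t > 0"
  have "q (t *\<^sub>R u + (t * s) *\<^sub>R z) = t * q (u + s *\<^sub>R z)"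
    using sublinear_scale[OF q, of t "u + s *\<^sub>R z"] st by (simp add: algebra_simps)
  with st show "\<exists>k\<in>{0..}. q (t *\<^sub>R u + k *\<^sub>R z) - k * q z \<le> t * (q (u + s *\<^sub>R z) - s * q z)"
    by (intro bexI[where x = "t * s"]) (auto simp: algebra_simps)
qed auto

text \<open>A minimal functional equals each of its directional reductions, and the parameter \<open>t = 1\<close> then
  gives the superadditivity that sublinearity lacks.\<close>

lemma minimal_sublinear_imp_linear:
  assumes q: "sublinear q"
    and minimal: "\<And>r. sublinear r \<Longrightarrow> r \<le> q \<Longrightarrow> r = q"
  shows "linear q"
proof -
  have add: "q (u + v) = q u + q v" for u v
  proof -
    have "directional_reduction q v \<le> q"
      using directional_reduction_le[OF q, of 0 v] by (simp add: le_fun_def)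
    then have "directional_reduction q v = q"
      using minimal sublinear_directional_reduction[OF q] by blast
    then show ?thesis
      using directional_reduction_le[OF q, of 1 v u] sublinear_add[OF q, of u v] by simp
  qed
  have neg: "q (- u) = - q u" for u
    using add[of u "- u"] sublinear_zero[OF q] by simp
  have "q (t *\<^sub>R u) = t * q u" for t u
  proof (cases "t \<ge> 0")
    case False
    then have "q ((- t) *\<^sub>R u) = (- t) * q u"
      by (intro sublinear_scale[OF q]) simp
    then show ?thesis
      using neg[of "t *\<^sub>R u"] by simp
  qed (rule sublinear_scale[OF q])
  with add show ?thesis
    by (intro linearI) auto
qed

text \<open>The infimum of a nonempty chain of sublinear functionals below \<open>p\<close> is finite because each
  member \<open>q\<close> satisfies \<open>q u \<ge> - q (- u) \<ge> - p (- u)\<close>.\<close>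

lemma minimal_sublinear_exists:
  assumes p: "sublinear p"
  obtains q where "sublinear q" "q \<le> p" "\<And>r. sublinear r \<Longrightarrow> r \<le> q \<Longrightarrow> r = q"
proof -
  define A where "A = {q. sublinear q \<and> q \<le> p}"
  have "\<exists>m\<in>A. \<forall>a\<in>A. m \<ge> a \<longrightarrow> a = m"
  proof (rule predicate_Zorn)
    show "partial_order_on A (relation_of (\<ge>) A)"
      by (auto simp: partial_order_on_def preorder_on_def relation_of_def
          intro!: refl_onI transI antisymI)
  next
    fix C
    assume "C \<in> Chains (relation_of (\<ge>) A)"
    then have CA: "C \<subseteq> A" and chain: "\<And>a b. a \<in> C \<Longrightarrow> b \<in> C \<Longrightarrow> a \<ge> b \<or> b \<ge> a"
      by (auto simp: Chains_def relation_of_def)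
    show "\<exists>b\<in>A. \<forall>a\<in>C. a \<ge> b"
    proof (cases "C = {}")
      case True
      with p show ?thesis by (auto simp: A_def)
    next
      case False
      define g where "g u = (INF a\<in>C. a u)" for u
      have bdd: "bdd_below ((\<lambda>a. a u) ` C)" for u
      proof (rule bdd_belowI2[where m = "- p (- u)"])
        fix a assume "a \<in> C"
        then have "sublinear a" "a (- u) \<le> p (- u)"
          using CA by (auto simp: A_def le_fun_def)
        then show "- p (- u) \<le> a u"
          using sublinear_lower[of a u] by linarith
      qed
      have sub: "sublinear a" if "a \<in> C" for a
        using CA that by (auto simp: A_def)
      have "sublinear g"
        unfolding g_def
      proof (rule sublinear_INF[OF False bdd])
        fix a b u v
        assume ab: "a \<in> C" "b \<in> C"
        show "\<exists>k\<in>C. k (u + v) \<le> a u + b v"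
        proof (cases "a \<le> b")
          case True
          then have "a (u + v) \<le> a u + b v"
            using sublinear_add[OF sub[OF ab(1)], of u v] le_funD[OF True, of v] by linarith
          with ab show ?thesis by blast
        next
          case False
          with ab have "b \<le> a"
            using chain by blast
          then have "b (u + v) \<le> a u + b v"
            using sublinear_add[OF sub[OF ab(2)], of u v] le_funD[of b a u] by linarith
          with ab show ?thesis by blast
        qed
      next
        show "a 0 = 0" if "a \<in> C" for a
          using sub[OF that] by (rule sublinear_zero)
      next
        fix a and t :: real and u
        assume a: "a \<in> C" and t: "t > 0"
        then have "a (t *\<^sub>R u) \<le> t * a u"
          using sublinear_scale[OF sub, of a t u] by simp
        with a show "\<exists>k\<in>C. k (t *\<^sub>R u) \<le> t * a u"
          by (intro bexI[where x = a])
      qed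
      moreover have g_le: "g \<le> a" if "a \<in> C" for a
        unfolding g_def using bdd that by (auto simp: le_fun_def intro!: cINF_lower)
      moreover obtain a where "a \<in> C" "a \<le> p"
        using False CA by (auto simp: A_def)
      then have "g \<le> p"
        using g_le by (blast intro: order_trans)
      ultimately show ?thesis
        by (auto simp: A_def)
    qed
  qed
  then obtain m where "m \<in> A" and m: "\<And>a. a \<in> A \<Longrightarrow> a \<le> m \<Longrightarrow> a = m"
    by blast
  then show thesis
    by (intro that[of m]) (auto simp: A_def intro: order_trans)
qed

text \<open>Minimizing below the reduction of the norm along \<open>z\<close> rather than below the norm itself fixes the
  value at \<open>z\<close>, since that reduction is at most \<open>- \<parallel>z\<parallel>\<close> at \<open>- z\<close>.\<close>

theorem norming_functional:
  fixes z :: "'a::real_normed_vector"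
  obtains f :: "'a \<Rightarrow> real"
  where "bounded_linear f" "\<And>u. \<bar>f u\<bar> \<le> norm u" "f z = norm z"
proof -
  define p where "p = directional_reduction norm z"
  have "sublinear p"
    unfolding p_def by (intro sublinear_directional_reduction sublinear_norm)
  then obtain f where f: "sublinear f" "f \<le> p" "\<And>r. sublinear r \<Longrightarrow> r \<le> f \<Longrightarrow> r = f"
    by (rule minimal_sublinear_exists) blast
  have lin: "linear f"
    using f(1,3) by (rule minimal_sublinear_imp_linear)
  have le: "f u \<le> norm u" for u
    using directional_reduction_le[OF sublinear_norm, of 0 z u] le_funD[OF f(2), of u]
    by (simp add: p_def)
  have abs: "\<bar>f u\<bar> \<le> norm u" for u
    using le[of u] le[of "- u"] linear_neg[OF lin, of u] by simp
  have "f (- z) \<le> - norm z"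
    using directional_reduction_le[OF sublinear_norm, of 1 z "- z"] le_funD[OF f(2), of "- z"]
    by (simp add: p_def)
  then have "f z = norm z"
    using le[of z] linear_neg[OF lin, of z] by simp
  moreover have "bounded_linear f"
    using lin abs
    by (auto simp: bounded_linear_def bounded_linear_axioms_def intro!: exI[where x = 1])
  ultimately show thesis
    using abs that by blast
qed

section \<open>Existence\<close>

lemma weakly_converges_subseq:
  assumes "weakly_converges x l" "strict_mono r"
  shows "weakly_converges (x \<circ> r) l"
  unfolding weakly_converges_def
proof (intro allI impI)
  fix f :: "'a \<Rightarrow> real"
  assume "bounded_linear f"
  then have "(\<lambda>n. f (x n)) \<longlonglongrightarrow> f l"
    using assms(1) by (simp add: weakly_converges_def)
  from LIMSEQ_subseq_LIMSEQ[OF this assms(2)] show "(\<lambda>n. f ((x \<circ> r) n)) \<longlonglongrightarrow> f l"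
    by (simp add: o_def)
qed

lemma is_arg_min_iff_le:
  fixes J :: "'a \<Rightarrow> real"
  shows "is_arg_min J (\<lambda>x. x \<in> D) z \<longleftrightarrow> z \<in> D \<and> (\<forall>x\<in>D. J z \<le> J x)"
  by (auto simp: is_arg_min_linorder)

lemma minimizing_sequence_exists:
  fixes J :: "'a \<Rightarrow> real"
  assumes ne: "D \<noteq> {}" and bdd: "bdd_below (J ` D)"
  obtains x where "range x \<subseteq> D" "(\<lambda>n. J (x n)) \<longlonglongrightarrow> Inf (J ` D)"
proof -
  have "\<exists>x\<in>D. J x < Inf (J ` D) + inverse (real (Suc n))" for n
    using cInf_lessD[of "J ` D" "Inf (J ` D) + inverse (real (Suc n))"] ne by auto
  then obtain x where x: "\<And>n. x n \<in> D" "\<And>n. J (x n) < Inf (J ` D) + inverse (real (Suc n))"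
    by metis
  have "(\<lambda>n. J (x n)) \<longlonglongrightarrow> Inf (J ` D)"
  proof (rule tendsto_sandwich[OF _ _ tendsto_const LIMSEQ_inverse_real_of_nat_add])
    show "\<forall>\<^sub>F n in sequentially. Inf (J ` D) \<le> J (x n)"
      using x(1) bdd by (intro always_eventually allI cInf_lower) auto
    show "\<forall>\<^sub>F n in sequentially. J (x n) \<le> Inf (J ` D) + inverse (real (Suc n))"
      using x(2) by (intro always_eventually allI less_imp_le)
  qed
  with x(1) show thesis
    by (intro that[of x]) auto
qed

lemma W_bounded_if_J_functional_bounded:
  assumes "\<alpha> > 0"
    and W: "\<And>x. x \<in> S \<Longrightarrow> W x \<ge> - \<gamma>"
    and J: "\<And>x. x \<in> S \<Longrightarrow> J_functional T y W \<alpha> x \<le> c"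
  shows "W_bounded W S"
  unfolding W_bounded_def
proof (intro exI ballI)
  fix x
  assume "x \<in> S"
  then have "\<alpha> * W x \<le> c"
    using J[of x] zero_le_power2[of "norm (T x - y)"] unfolding J_functional_def by linarith
  then have "W x \<le> c / \<alpha>"
    using \<open>\<alpha> > 0\<close> by (simp add: le_divide_eq mult.commute)
  then show "\<bar>W x\<bar> \<le> \<bar>\<gamma>\<bar> + \<bar>c / \<alpha>\<bar>"
    using W[OF \<open>x \<in> S\<close>] by linarith
qed

text \<open>Testing against a functional that norms \<open>T l - y\<close> replaces the discrepancy by a convergent lower
  bound. Hence \<open>W (x n)\<close> lies below a sequence converging to \<open>(m - \<parallel>T l - y\<parallel>\<^sup>2) / \<alpha>\<close>, and so does its
  lower limit.\<close>

lemma tikhonov_minimizer_of_weak_limit: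
  fixes T :: "'a::real_normed_vector \<Rightarrow> 'b::real_normed_vector"
  assumes T: "bounded_linear T" and "\<alpha> > 0"
    and weak: "weakly_converges x l"
    and W: "ereal (W l) \<le> liminf (\<lambda>n. ereal (W (x n)))"
    and J: "(\<lambda>n. J_functional T y W \<alpha> (x n)) \<longlonglongrightarrow> m"
  shows "J_functional T y W \<alpha> l \<le> m"
proof -
  obtain f :: "'b \<Rightarrow> real" where f: "bounded_linear f" "\<And>u. \<bar>f u\<bar> \<le> norm u"
      "f (T l - y) = norm (T l - y)"
    by (rule norming_functional[of "T l - y"]) blast
  have "(\<lambda>n. f (T (x n))) \<longlonglongrightarrow> f (T l)"
    using weak bounded_linear_compose[OF f(1) T] by (auto simp: weakly_converges_def)
  then have "(\<lambda>n. f (T (x n) - y)) \<longlonglongrightarrow> norm (T l - y)"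
    unfolding f(3)[symmetric] linear_diff[OF bounded_linear.linear[OF f(1)]]
    by (intro tendsto_diff tendsto_const)
  then have "(\<lambda>n. (J_functional T y W \<alpha> (x n) - (f (T (x n) - y))\<^sup>2) / \<alpha>)
      \<longlonglongrightarrow> (m - (norm (T l - y))\<^sup>2) / \<alpha>"
    using \<open>\<alpha> > 0\<close> by (intro tendsto_intros J) auto
  then have "liminf (\<lambda>n. ereal ((J_functional T y W \<alpha> (x n) - (f (T (x n) - y))\<^sup>2) / \<alpha>))
      = ereal ((m - (norm (T l - y))\<^sup>2) / \<alpha>)"
    by (intro lim_imp_Liminf) auto
  moreover have "W (x n) \<le> (J_functional T y W \<alpha> (x n) - (f (T (x n) - y))\<^sup>2) / \<alpha>" for n
  proof -
    have "(f (T (x n) - y))\<^sup>2 \<le> (norm (T (x n) - y))\<^sup>2"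
      using f(2)[of "T (x n) - y"] by (simp add: abs_le_square_iff[symmetric])
    then show ?thesis
      using \<open>\<alpha> > 0\<close> by (simp add: J_functional_def le_divide_eq mult.commute)
  qed
  then have "liminf (\<lambda>n. ereal (W (x n)))
      \<le> liminf (\<lambda>n. ereal ((J_functional T y W \<alpha> (x n) - (f (T (x n) - y))\<^sup>2) / \<alpha>))"
    by (intro Liminf_mono always_eventually) simp
  ultimately have "W l \<le> (m - (norm (T l - y))\<^sup>2) / \<alpha>"
    using W by (metis ereal_less_eq(3) order_trans)
  then show ?thesis
    using \<open>\<alpha> > 0\<close> by (simp add: J_functional_def le_divide_eq mult.commute)
qed

section \<open>Uniqueness\<close>

lemma norm_midpoint_square_le:
  fixes u v :: "'b::real_normed_vector"
  shows "(norm ((1/2) *\<^sub>R (u + v)))\<^sup>2 \<le> ((norm u)\<^sup>2 + (norm v)\<^sup>2) / 2"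
proof -
  have "norm ((1/2) *\<^sub>R (u + v)) \<le> (norm u + norm v) / 2"
    using norm_triangle_ineq[of u v] by simp
  then have "(norm ((1/2) *\<^sub>R (u + v)))\<^sup>2 \<le> ((norm u + norm v) / 2)\<^sup>2"
    by (rule power_mono) simp
  also have "\<dots> \<le> ((norm u)\<^sup>2 + (norm v)\<^sup>2) / 2"
    using zero_le_power2[of "norm u - norm v"] by (simp add: power2_eq_square algebra_simps)
  finally show ?thesis .
qed

text \<open>Vectors of different norms are separated by strict convexity of the square, whatever the norm.
  Only for vectors of equal norm does the shape of the unit sphere matter.\<close>

lemma rotund_norm_midpoint_square_less:
  fixes u v :: "'b::real_normed_vector"
  assumes rot: "rotund TYPE('b)" and "u \<noteq> v"
  shows "(norm ((1/2) *\<^sub>R (u + v)))\<^sup>2 < ((norm u)\<^sup>2 + (norm v)\<^sup>2) / 2"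
proof (cases "norm u = norm v")
  case True
  define a where "a = norm u"
  have "a > 0"
    using True \<open>u \<noteq> v\<close> by (auto simp: a_def)
  have "norm (u /\<^sub>R a) = 1" "norm (v /\<^sub>R a) = 1" "u /\<^sub>R a \<noteq> v /\<^sub>R a"
    using \<open>a > 0\<close> True \<open>u \<noteq> v\<close> by (auto simp: a_def)
  then have "norm (u /\<^sub>R a + v /\<^sub>R a) < 2"
    using rot unfolding rotund_def by blast
  then have "norm (u + v) / a < 2"
    using \<open>a > 0\<close> by (simp only: norm_scaleR divide_inverse_commute abs_of_pos
        positive_imp_inverse_positive flip: scaleR_add_right)
  then have "norm (u + v) < 2 * a"
    using \<open>a > 0\<close> by (simp add: divide_less_eq)
  then have "norm ((1/2) *\<^sub>R (u + v)) < a"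
    by simp
  then have "(norm ((1/2) *\<^sub>R (u + v)))\<^sup>2 < a\<^sup>2"
    by (rule power_strict_mono) auto
  then show ?thesis
    using True by (simp add: a_def)
next
  case False
  have "norm ((1/2) *\<^sub>R (u + v)) \<le> (norm u + norm v) / 2"
    using norm_triangle_ineq[of u v] by simp
  then have "(norm ((1/2) *\<^sub>R (u + v)))\<^sup>2 \<le> ((norm u + norm v) / 2)\<^sup>2"
    by (rule power_mono) simp
  also have "\<dots> < ((norm u)\<^sup>2 + (norm v)\<^sup>2) / 2"
    using False zero_less_power2[of "norm u - norm v"]
    by (simp add: power2_eq_square algebra_simps)
  finally show ?thesis .
qed

lemma J_functional_midpoint_less:
  fixes T :: "'a::real_normed_vector \<Rightarrow> 'b::real_normed_vector"
  assumes T: "bounded_linear T" and "\<alpha> > 0"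
    and conv: "(convex_on D W \<and> inj T \<and> rotund TYPE('b)) \<or> strictly_convex_on D W"
    and mem: "x \<in> D" "z \<in> D" and "x \<noteq> z"
  shows "J_functional T y W \<alpha> ((1/2) *\<^sub>R x + (1/2) *\<^sub>R z)
    < (J_functional T y W \<alpha> x + J_functional T y W \<alpha> z) / 2"
proof -
  define w where "w = (1/2) *\<^sub>R x + (1/2) *\<^sub>R z"
  have "T w = (1/2) *\<^sub>R T x + (1/2) *\<^sub>R T z"
    using bounded_linear.linear[OF T] by (simp add: w_def linear_add linear_scale)
  moreover have "y = (1/2) *\<^sub>R y + (1/2) *\<^sub>R y"
    by (simp flip: scaleR_add_left)
  ultimately have "T w - y = ((1/2) *\<^sub>R T x + (1/2) *\<^sub>R T z) - ((1/2) *\<^sub>R y + (1/2) *\<^sub>R y)"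
    by (rule arg_cong2[where f = minus])
  then have Tw: "T w - y = (1/2) *\<^sub>R ((T x - y) + (T z - y))"
    by (simp only: scaleR_add_right scaleR_diff_right add_diff_add)
  have norm_le: "(norm (T w - y))\<^sup>2 \<le> ((norm (T x - y))\<^sup>2 + (norm (T z - y))\<^sup>2) / 2"
    unfolding Tw by (rule norm_midpoint_square_le)
  have "(norm (T w - y))\<^sup>2 + \<alpha> * W w
      < ((norm (T x - y))\<^sup>2 + (norm (T z - y))\<^sup>2) / 2 + \<alpha> * ((W x + W z) / 2)"
    using conv
  proof
    assume *: "convex_on D W \<and> inj T \<and> rotund TYPE('b)"
    then have "W w \<le> (W x + W z) / 2"
      using convex_onD[of D W "1/2" x z] mem by (simp add: w_def)
    moreover have "(norm (T w - y))\<^sup>2 < ((norm (T x - y))\<^sup>2 + (norm (T z - y))\<^sup>2) / 2"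
      unfolding Tw using * \<open>x \<noteq> z\<close>
      by (intro rotund_norm_midpoint_square_less) (auto dest: injD)
    ultimately show ?thesis
      using \<open>\<alpha> > 0\<close> by (intro add_less_le_mono mult_left_mono) auto
  next
    assume "strictly_convex_on D W"
    then have "W w < (1/2) * W x + (1/2) * W z"
      using mem \<open>x \<noteq> z\<close> unfolding strictly_convex_on_def w_def
      by (metis (no_types) field_sum_of_halves zero_less_divide_1_iff zero_less_numeral)
    then have "W w < (W x + W z) / 2"
      by simp
    then show ?thesis
      using norm_le \<open>\<alpha> > 0\<close> by (intro add_le_less_mono mult_strict_left_mono) auto
  qed
  then show ?thesis
    by (simp add: J_functional_def w_def[symmetric] field_simps)
qed

section \<open>Regularized least squares\<close>

theorem theorem2p5:
  fixes T :: "'a::real_normed_vector \<Rightarrow> 'b::real_normed_vector"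
    and y :: 'b and \<alpha> \<gamma> :: real and D :: "'a set" and W :: "'a \<Rightarrow> real"
  assumes "bounded_linear T"
    and "\<alpha> > 0"
    and "D \<noteq> {}" and "convex D"
    and "\<gamma> \<ge> 0" and "\<And>x. x \<in> D \<Longrightarrow> W x \<ge> - \<gamma>"
    and "\<And>x l. range x \<subseteq> D \<Longrightarrow> W_bounded W (range x) \<Longrightarrow> l \<in> D \<Longrightarrow> weakly_converges x l \<Longrightarrow>
           \<exists>r :: nat \<Rightarrow> nat. strict_mono r \<and>
             ereal (W l) \<le> liminf (\<lambda>j. ereal (W (x (r j))))"
    and "\<And>x. range x \<subseteq> D \<Longrightarrow> W_bounded W (range x) \<Longrightarrow>
           \<exists>r :: nat \<Rightarrow> nat. \<exists>l\<in>D. strict_mono r \<and> weakly_converges (x \<circ> r) l"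
  shows "(\<exists>z. is_arg_min (J_functional T y W \<alpha>) (\<lambda>x. x \<in> D) z) \<and>
    ((convex_on D W \<and> inj T \<and> rotund TYPE('b)) \<or> strictly_convex_on D W \<longrightarrow>
      (\<exists>!z. is_arg_min (J_functional T y W \<alpha>) (\<lambda>x. x \<in> D) z))"
proof -
  let ?J = "J_functional T y W \<alpha>"
  have "bdd_below (?J ` D)"
  proof (rule bdd_belowI2[where m = "\<alpha> * (- \<gamma>)"])
    fix x assume "x \<in> D"
    then have "\<alpha> * (- \<gamma>) \<le> \<alpha> * W x"
      using assms(2,6) by (intro mult_left_mono) auto
    then show "\<alpha> * (- \<gamma>) \<le> ?J x"
      using zero_le_power2[of "norm (T x - y)"] unfolding J_functional_def by linarith
  qed
  then obtain x where x: "range x \<subseteq> D" and lim: "(\<lambda>n. ?J (x n)) \<longlonglongrightarrow> Inf (?J ` D)"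
    using minimizing_sequence_exists[OF assms(3)] by metis
  obtain c where c: "\<And>n. ?J (x n) \<le> c"
    using convergent_imp_Bseq[OF convergentI[OF lim]] unfolding Bseq_def real_norm_def
    by (meson abs_le_D1)
  have bounded: "W_bounded W (range x)"
    using assms(2)
  proof (rule W_bounded_if_J_functional_bounded)
    show "W u \<ge> - \<gamma>" if "u \<in> range x" for u
      using that x assms(6) by blast
    show "?J u \<le> c" if "u \<in> range x" for u
      using that c by blast
  qed
  obtain r :: "nat \<Rightarrow> nat" and l
    where r: "l \<in> D" "strict_mono r" "weakly_converges (x \<circ> r) l"
    using assms(8)[OF x bounded] by blast
  have "range (x \<circ> r) \<subseteq> D" "W_bounded W (range (x \<circ> r))"
    using x bounded by (auto simp: W_bounded_def)
  from assms(7)[OF this r(1,3)] obtain s :: "nat \<Rightarrow> nat" where s: "strict_mono s"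
      "ereal (W l) \<le> liminf (\<lambda>j. ereal (W ((x \<circ> r) (s j))))"
    by blast
  have "?J l \<le> Inf (?J ` D)"
  proof (rule tikhonov_minimizer_of_weak_limit[OF assms(1,2)])
    show "weakly_converges ((x \<circ> r) \<circ> s) l"
      using r(3) s(1) by (rule weakly_converges_subseq)
    show "ereal (W l) \<le> liminf (\<lambda>j. ereal (W (((x \<circ> r) \<circ> s) j)))"
      using s(2) by simp
    show "(\<lambda>n. ?J (((x \<circ> r) \<circ> s) n)) \<longlonglongrightarrow> Inf (?J ` D)"
      using LIMSEQ_subseq_LIMSEQ[OF lim strict_mono_o[OF r(2) s(1)]] by (simp add: o_def)
  qed
  then have "?J l \<le> ?J u" if "u \<in> D" for u
    using cINF_lower[OF \<open>bdd_below (?J ` D)\<close> that] by linarith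
  with r(1) have exist: "is_arg_min ?J (\<lambda>x. x \<in> D) l"
    by (auto simp: is_arg_min_iff_le)
  have unique: "z = z'"
    if conv: "(convex_on D W \<and> inj T \<and> rotund TYPE('b)) \<or> strictly_convex_on D W"
      and z: "is_arg_min ?J (\<lambda>x. x \<in> D) z" "is_arg_min ?J (\<lambda>x. x \<in> D) z'" for z z'
  proof (rule ccontr)
    assume "z \<noteq> z'"
    have D: "z \<in> D" "z' \<in> D"
      using z by (auto simp: is_arg_min_iff_le)
    define w where "w = (1/2) *\<^sub>R z + (1/2) *\<^sub>R z'"
    have "w \<in> D"
      unfolding w_def using assms(4) D by (rule convexD) auto
    then have "?J z \<le> ?J w" "?J z' \<le> ?J w"
      using z by (auto simp: is_arg_min_iff_le)
    moreover have "?J w < (?J z + ?J z') / 2"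
      unfolding w_def using assms(1,2) conv D \<open>z \<noteq> z'\<close> by (rule J_functional_midpoint_less)
    ultimately show False
      by (simp add: field_simps)
  qed
  from exist unique show ?thesis
    by blast
qed

end
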